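(* The problem of (sampling) recovery in the uniform norm on the classes $F_d^{\log}$ suffers from the curse of dimensionality. For any $d\in\mathbb{N}$ and any mapping $A_n\colon F_d^{\log}\to L_\infty([0,1]^d)$ of the form $A_n(f)=\phi(L_1(f),\dots,L_n(f))$, where $L_1,\dots,L_n\colon F_d^{\log}\to\mathbb{C}$ are linear functionals, possibly chosen adaptively, and $\phi\colon\mathbb{C}^n\to L_\infty([0,1]^d)$ is an arbitrary map, with $n\le 5^d/2$, we have \[ \sup_{f\in F_d^{\log}}\|f-A_n(f)\|_\infty\,\ge\,\frac{1}{\sqrt 2}. \]
   Context: For $f\in C([0,1]^d)$ (continuous, complex-valued) and $k\in\mathbb{Z}^d$, let $\hat f(k)=\int_{[0,1]^d} f(x)e^{-2\pi i\langle k,x\rangle}\,dx$. Define the function class \[ F_d^{\log}:=\Big\{f\in C([0,1]^d)\ \Big|\ \sum_{k\in\mathbb{Z}^d}|\hat f(k)|\max(1,\log\|k\|_\infty)\le 1\Big\}, \] where the factor $\max(1,\log\|k\|_\infty)$ equals $1$ for $k=0$. A linear functional on $F_d^{\log}$ means the restriction of a linear functional defined on the linear span of $F_d^{\log}$. "Possibly chosen adaptively" means that the choice of the linear functional $L_j$ may depend on the previously obtained values $L_1(f),\dots,L_{j-1}(f)$. The algorithms considered include in particular sampling algorithms $A_n(f)=\phi(f(x_1),\dots,f(x_n))$ with $x_j\in[0,1]^d$. The problem of recovery in the uniform norm on the classes $F_d^{\log}$ suffers from the curse of dimensionality if there exist $C,\gamma,\varepsilon>0$ such that, for all $d\in\mathbb{N}$,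 the minimal $n$ for which some algorithm $A_n$ of the form described in the claim satisfies $\sup_{f\in F_d^{\log}}\|f-A_n(f)\|_\infty\le\varepsilon$ is bounded below by $C(1+\gamma)^d$. *)

theory Defs
  imports "HOL-Probability.Probability" "HOL-Library.Function_Algebras"
begin

text \<open>
  The dimension is quantified inside the statement, so points of \<open>\<real>\<^sup>d\<close> and
  frequencies in \<open>\<int>\<^sup>d\<close> are extensional functions on \<open>{..<d}\<close>.
  The product topology of \<^typ>\<open>nat \<Rightarrow> real\<close> induces on \<open>cube d\<close> the Euclidean topology.
\<close>

definition cube :: "nat \<Rightarrow> (nat \<Rightarrow> real) set" where
  "cube d = {..<d} \<rightarrow>\<^sub>E {0..1}"

definition cube_measure :: "nat \<Rightarrow> (nat \<Rightarrow> real) measure" where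
  "cube_measure d = (\<Pi>\<^sub>M i\<in>{..<d}. restrict_space lborel {0..1})"

definition int_lattice :: "nat \<Rightarrow> (nat \<Rightarrow> int) set" where
  "int_lattice d = {..<d} \<rightarrow>\<^sub>E UNIV"

type_synonym cfun = "(nat \<Rightarrow> real) \<Rightarrow> complex"

text \<open>
  A function on the cube is represented by its extension by zero to the whole type, so that
  equality and the pointwise vector space operations agree with those on \<open>C([0,1]\<^sup>d)\<close>.
\<close>

definition C_cube :: "nat \<Rightarrow> cfun set" where
  "C_cube d = {f. continuous_on (cube d) f \<and> (\<forall>x. x \<notin> cube d \<longrightarrow> f x = 0)}"

definition fourier_coeff :: "nat \<Rightarrow> cfun \<Rightarrow> (nat \<Rightarrow> int) \<Rightarrow> complex" where
  "fourier_coeff d f k =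
     (LINT x|cube_measure d. f x * exp (- 2 * pi * \<i> * of_real (\<Sum>i<d. of_int (k i) * x i)))"

definition sup_norm :: "nat \<Rightarrow> (nat \<Rightarrow> int) \<Rightarrow> real" where
  "sup_norm d k = real_of_int (Max ((\<lambda>i. \<bar>k i\<bar>) ` {..<d}))"

definition log_weight :: "nat \<Rightarrow> (nat \<Rightarrow> int) \<Rightarrow> real" where
  "log_weight d k = (if \<forall>i<d. k i = 0 then 1 else max 1 (ln (sup_norm d k)))"

definition F_log :: "nat \<Rightarrow> cfun set" where
  "F_log d = {f \<in> C_cube d.
     (\<lambda>k. cmod (fourier_coeff d f k) * log_weight d k) summable_on int_lattice d \<and>
     (\<Sum>\<^sub>\<infinity>k\<in>int_lattice d. cmod (fourier_coeff d f k) * log_weight d k) \<le> 1}"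

definition Linf_norm :: "nat \<Rightarrow> cfun \<Rightarrow> ereal" where
  "Linf_norm d g = esssup (cube_measure d) (\<lambda>x. ereal (cmod (g x)))"

text \<open>Elements of \<open>L\<^sub>\<infinity>([0,1]\<^sup>d)\<close> are given by Borel measurable representatives.\<close>

definition Linf :: "nat \<Rightarrow> cfun set" where
  "Linf d = {g \<in> borel_measurable (cube_measure d). Linf_norm d g < \<infinity>}"

definition cfun_scale :: "complex \<Rightarrow> cfun \<Rightarrow> cfun" where
  "cfun_scale c f = (\<lambda>x. c * f x)"

global_interpretation cfun: vector_space cfun_scale
  by unfold_locales (auto simp: cfun_scale_def fun_eq_iff algebra_simps)

text \<open>Only the values of \<open>L\<close> on the linear span of \<open>F\<close> matter.\<close>

definition linear_functional_on :: "cfun set \<Rightarrow> (cfun \<Rightarrow> complex) \<Rightarrow> bool" where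
  "linear_functional_on F L \<longleftrightarrow>
     (\<forall>f\<in>cfun.span F. \<forall>g\<in>cfun.span F. L (f + g) = L f + L g) \<and>
     (\<forall>c. \<forall>f\<in>cfun.span F. L (cfun_scale c f) = c * L f)"

text \<open>
  \<open>L ys\<close> is the functional evaluated after the values \<open>ys\<close> have been observed;
  \<open>adaptive_info L n f\<close> is the list of the first \<open>n\<close> values obtained for the input \<open>f\<close>.
\<close>

primrec adaptive_info :: "(complex list \<Rightarrow> cfun \<Rightarrow> complex) \<Rightarrow> nat \<Rightarrow> cfun \<Rightarrow> complex list" where
  "adaptive_info L 0 f = []"
| "adaptive_info L (Suc n) f = adaptive_info L n f @ [L (adaptive_info L n f) f]"

definition adaptive_algorithms :: "nat \<Rightarrow> cfun set \<Rightarrow> nat \<Rightarrow> (cfun \<Rightarrow> cfun) set" where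
  "adaptive_algorithms d F n = {A. \<exists>L \<phi>.
     (\<forall>ys. length ys < n \<longrightarrow> linear_functional_on F (L ys)) \<and>
     (\<forall>ys. length ys = n \<longrightarrow> \<phi> ys \<in> Linf d) \<and>
     (\<forall>f\<in>F. A f = \<phi> (adaptive_info L n f))}"

definition sampling_algorithms :: "nat \<Rightarrow> cfun set \<Rightarrow> nat \<Rightarrow> (cfun \<Rightarrow> cfun) set" where
  "sampling_algorithms d F n = {A. \<exists>x \<phi>.
     (\<forall>j<n. x j \<in> cube d) \<and>
     (\<forall>ys. length ys = n \<longrightarrow> \<phi> ys \<in> Linf d) \<and>
     (\<forall>f\<in>F. A f = \<phi> (map (\<lambda>j. f (x j)) [0..<n]))}"

definition worst_case_error :: "nat \<Rightarrow> cfun set \<Rightarrow> (cfun \<Rightarrow> cfun) \<Rightarrow> ereal" where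
  "worst_case_error d F A = (SUP f\<in>F. Linf_norm d (f - A f))"

text \<open>The minimal \<open>n\<close>; it is \<open>\<infinity>\<close> if no algorithm achieves the error \<open>\<epsilon>\<close>.\<close>

definition info_complexity ::
    "(nat \<Rightarrow> cfun set \<Rightarrow> nat \<Rightarrow> (cfun \<Rightarrow> cfun) set) \<Rightarrow> (nat \<Rightarrow> cfun set) \<Rightarrow> real \<Rightarrow> nat \<Rightarrow> enat" where
  "info_complexity alg F \<epsilon> d =
     Inf {enat n | n. \<exists>A\<in>alg d (F d) n. worst_case_error d (F d) A \<le> ereal \<epsilon>}"

definition curse_of_dimensionality ::
    "(nat \<Rightarrow> cfun set \<Rightarrow> nat \<Rightarrow> (cfun \<Rightarrow> cfun) set) \<Rightarrow> (nat \<Rightarrow> cfun set) \<Rightarrow> bool" where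
  "curse_of_dimensionality alg F \<longleftrightarrow> (\<exists>C \<gamma> \<epsilon>. C > 0 \<and> \<gamma> > 0 \<and> \<epsilon> > 0 \<and>
     (\<forall>d\<ge>1. ereal (C * (1 + \<gamma>) ^ d) \<le> ereal_of_enat (info_complexity alg F \<epsilon> d)))"

end

theory Submission
  imports Defs
begin

text \<open>
  Every frequency in \<open>{-2..2}\<^sup>d\<close> has weight \<open>1\<close>, because \<open>ln 2 \<le> 1\<close>. So \<open>F_log d\<close> contains all
  trigonometric polynomials with these \<open>N = 5 ^ d\<close> frequencies and coefficient sum at most \<open>1\<close>, and
  the lower bound already holds on this finite-dimensional subset.

  Feed the algorithm with functions for which all information is zero. The functionals chosen along
  the all-zero history are fixed in advance, so \<open>n\<close> linear conditions on the coefficients ensure that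
  both \<open>f\<close> and \<open>- f\<close> follow this history (\<open>adaptive_info_zero\<close>). Both then receive the same answer,
  and the error on one of them is at least the maximum of \<open>\<bar>f\<bar>\<close>
  (\<open>worst_case_error_symmetric_pair\<close>).

  It remains to find such an \<open>f\<close> with coefficient sum \<open>1\<close> and a value of modulus at least
  \<open>1 / sqrt 2\<close>, when \<open>n \<le> N / 2\<close> (\<open>exists_peaked_combination\<close>). Project the vector that represents
  the evaluation at \<open>x\<close> orthogonally onto the kernel of the \<open>n\<close> conditions. The squared length of the
  projection, averaged over \<open>x\<close>, is the dimension of the kernel, which is at least \<open>N / 2\<close>. For a point
  \<open>x\<close> that reaches this average, the projected vector, divided by its coefficient sum, gives \<open>f\<close>: its
  value at \<open>x\<close> is the squared length, and Cauchy--Schwarz bounds the coefficient sum by \<open>sqrt N\<close>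
  times the length.
\<close>

section \<open>Orthogonal complements of finitely many functionals\<close>

definition inner_on :: "'k set \<Rightarrow> ('k \<Rightarrow> complex) \<Rightarrow> ('k \<Rightarrow> complex) \<Rightarrow> complex" where
  "inner_on K u v = (\<Sum>k\<in>K. u k * cnj (v k))"

text \<open>
  For an orthonormal system \<open>v 0, \<dots>, v (m - 1)\<close> this is the orthogonal projection of \<open>u\<close>
  onto its orthogonal complement.
\<close>

definition residual :: "'k set \<Rightarrow> nat \<Rightarrow> (nat \<Rightarrow> 'k \<Rightarrow> complex) \<Rightarrow> ('k \<Rightarrow> complex) \<Rightarrow> 'k \<Rightarrow> complex" where
  "residual K m v u = (\<lambda>k. u k - (\<Sum>i<m. inner_on K u (v i) * v i k))"

lemma inner_on_commute: "inner_on K v u = cnj (inner_on K u v)"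
  by (simp add: inner_on_def mult.commute)

lemma inner_on_diff_left: "inner_on K (\<lambda>k. u k - w k) v = inner_on K u v - inner_on K w v"
  by (simp add: inner_on_def left_diff_distrib sum_subtractf)

lemma inner_on_sum_left:
  "inner_on K (\<lambda>k. \<Sum>i\<in>I. a i * w i k) v = (\<Sum>i\<in>I. a i * inner_on K (w i) v)"
  by (simp add: inner_on_def sum_distrib_left sum_distrib_right mult.assoc sum.swap[of _ K I])

lemma inner_on_self: "inner_on K u u = of_real (\<Sum>k\<in>K. (cmod (u k))\<^sup>2)"
  by (simp add: inner_on_def complex_norm_square del: of_real_power)

lemma inner_on_residual_orthogonal:
  assumes "\<And>i j. i < m \<Longrightarrow> j < m \<Longrightarrow> inner_on K (v i) (v j) = (if i = j then 1 else 0)" "j < m"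
  shows "inner_on K (residual K m v u) (v j) = 0"
proof -
  have "(\<Sum>i<m. inner_on K u (v i) * inner_on K (v i) (v j))
      = (\<Sum>i<m. if i = j then inner_on K u (v i) else 0)"
    using assms by (intro sum.cong) auto
  then show ?thesis
    using \<open>j < m\<close> by (simp add: residual_def inner_on_diff_left inner_on_sum_left)
qed

lemma inner_on_residual_right:
  assumes "\<And>i. i < m \<Longrightarrow> inner_on K c (v i) = 0"
  shows "inner_on K c (residual K m v u) = inner_on K c u"
proof -
  have "inner_on K (v i) c = 0" if "i < m" for i
    using assms[OF that] inner_on_commute[of K "v i" c] by simp
  then have "inner_on K (residual K m v u) c = inner_on K u c"
    by (simp add: residual_def inner_on_diff_left inner_on_sum_left)
  then show ?thesis
    by (metis inner_on_commute)
qed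

lemma pythagoras_residual:
  assumes "\<And>i j. i < m \<Longrightarrow> j < m \<Longrightarrow> inner_on K (v i) (v j) = (if i = j then 1 else 0)"
  shows "(\<Sum>k\<in>K. (cmod (residual K m v u k))\<^sup>2)
      = (\<Sum>k\<in>K. (cmod (u k))\<^sup>2) - (\<Sum>i<m. (cmod (inner_on K u (v i)))\<^sup>2)"
proof -
  have "inner_on K (residual K m v u) (residual K m v u) = inner_on K (residual K m v u) u"
    by (rule inner_on_residual_right) (rule inner_on_residual_orthogonal[OF assms])
  also have "\<dots> = inner_on K u u - (\<Sum>i<m. inner_on K u (v i) * cnj (inner_on K u (v i)))"
    by (simp add: residual_def inner_on_diff_left inner_on_sum_left flip: inner_on_commute)
  also have "\<dots> = of_real ((\<Sum>k\<in>K. (cmod (u k))\<^sup>2) - (\<Sum>i<m. (cmod (inner_on K u (v i)))\<^sup>2))"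
    by (simp add: inner_on_self complex_norm_square del: of_real_power)
  finally show ?thesis
    unfolding inner_on_self of_real_eq_iff .
qed

text \<open>
  Gram--Schmidt: the constraints given by \<open>n\<close> arbitrary, possibly dependent vectors follow from
  orthogonality to at most \<open>n\<close> orthonormal ones. The projection onto the complement of the
  orthonormal system therefore lands in the common kernel.
\<close>

lemma orthonormal_reduction:
  fixes a :: "nat \<Rightarrow> 'k \<Rightarrow> complex"
  assumes "finite K"
  shows "\<exists>m v. m \<le> n \<and>
    (\<forall>i<m. \<forall>j<m. inner_on K (v i) (v j) = (if i = j then 1 else 0)) \<and>
    (\<forall>c. (\<forall>i<m. inner_on K c (v i) = 0) \<longrightarrow> (\<forall>j<n. inner_on K c (a j) = 0))"
proof (induction n)
  case 0
  show ?case by (rule exI[of _ 0]) simp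
next
  case (Suc n)
  then obtain m v where m: "m \<le> n"
    and on: "\<And>i j. i < m \<Longrightarrow> j < m \<Longrightarrow> inner_on K (v i) (v j) = (if i = j then 1 else 0)"
    and ker: "\<And>c j. (\<And>i. i < m \<Longrightarrow> inner_on K c (v i) = 0) \<Longrightarrow> j < n \<Longrightarrow> inner_on K c (a j) = 0"
    by blast
  define w where "w = residual K m v (a n)"
  define r where "r = sqrt (\<Sum>k\<in>K. (cmod (w k))\<^sup>2)"
  have ww: "inner_on K w w = of_real (r\<^sup>2)"
    by (simp add: inner_on_self r_def sum_nonneg)
  have wv: "inner_on K w (v i) = 0" if "i < m" for i
    unfolding w_def by (rule inner_on_residual_orthogonal[OF on that])
  have cw: "inner_on K c (a n) = inner_on K c w" if "\<And>i. i < m \<Longrightarrow> inner_on K c (v i) = 0" for c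
    unfolding w_def by (rule inner_on_residual_right[OF that, symmetric])
  \<comment> \<open>A vanishing residual means that the new constraint already follows from the old ones.\<close>
  show ?case
  proof (cases "r = 0")
    case True
    then have "w k = 0" if "k \<in> K" for k
      using that \<open>finite K\<close> by (simp add: r_def sum_nonneg_eq_0_iff)
    then have "inner_on K c w = 0" for c
      by (simp add: inner_on_def)
    then show ?thesis
      using m on ker cw
      by (intro exI[of _ m] exI[of _ v]) (auto simp: less_Suc_eq)
  next
    case False
    define v' where "v' = v(m := \<lambda>k. w k / of_real r)"
    have left: "inner_on K (\<lambda>k. w k / of_real r) y = inner_on K w y / of_real r" for y
      by (simp add: inner_on_def sum_divide_distrib)
    have right: "inner_on K y (\<lambda>k. w k / of_real r) = inner_on K y w / of_real r" for y
      by (simp add: inner_on_def sum_divide_distrib)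
    have vw: "inner_on K (v i) w = 0" if "i < m" for i
      using wv[OF that] inner_on_commute[of K "v i" w] by simp
    have on': "inner_on K (v' i) (v' j) = (if i = j then 1 else 0)" if "i < Suc m" "j < Suc m" for i j
      using that on wv vw False
      by (auto simp: v'_def left right ww less_Suc_eq power2_eq_square)
    have ker': "inner_on K c (a j) = 0"
      if c: "\<And>i. i < Suc m \<Longrightarrow> inner_on K c (v' i) = 0" and j: "j < Suc n" for c j
    proof -
      have cv: "inner_on K c (v i) = 0" if "i < m" for i
        using c[of i] that by (simp add: v'_def)
      have "inner_on K c w = 0"
        using c[of m] False by (simp add: v'_def right)
      then show ?thesis
        using ker[OF cv] cw[OF cv] j by (auto simp: less_Suc_eq)
    qed
    show ?thesis
      using m on' ker' by (intro exI[of _ "Suc m"] exI[of _ v']) auto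
  qed
qed

section \<open>A combination in the kernel with a large value\<close>

lemma (in prob_space) parseval_finite:
  fixes e :: "'k \<Rightarrow> 'a \<Rightarrow> complex"
  assumes "finite K"
    and meas: "\<And>k. k \<in> K \<Longrightarrow> e k \<in> borel_measurable M"
    and unimodular: "\<And>k x. k \<in> K \<Longrightarrow> x \<in> space M \<Longrightarrow> cmod (e k x) = 1"
    and orth: "\<And>k l. k \<in> K \<Longrightarrow> l \<in> K \<Longrightarrow>
      (LINT x|M. e k x * cnj (e l x)) = (if k = l then 1 else 0)"
  shows "integrable M (\<lambda>x. (cmod (\<Sum>k\<in>K. c k * e k x))\<^sup>2)" 
    and "(LINT x|M. (cmod (\<Sum>k\<in>K. c k * e k x))\<^sup>2) = (\<Sum>k\<in>K. (cmod (c k))\<^sup>2)"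
proof -
  have int: "integrable M (\<lambda>x. e k x * cnj (e l x))" if "k \<in> K" "l \<in> K" for k l
  proof (rule integrable_const_bound[where B = 1])
    show "(\<lambda>x. e k x * cnj (e l x)) \<in> borel_measurable M"
      using meas[OF that(1)] meas[OF that(2)]
      by (intro borel_measurable_times borel_measurable_continuous_on[of cnj] continuous_intros)
  qed (use that unimodular in \<open>auto simp: norm_mult\<close>)
  have expand: "of_real ((cmod (\<Sum>k\<in>K. c k * e k x))\<^sup>2)
      = (\<Sum>k\<in>K. \<Sum>l\<in>K. c k * cnj (c l) * (e k x * cnj (e l x)))" for x
    unfolding complex_norm_square by (simp add: sum_product mult_ac)
  have int2: "integrable M (\<lambda>x. complex_of_real ((cmod (\<Sum>k\<in>K. c k * e k x))\<^sup>2))"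
    unfolding expand using int by auto
  then show "integrable M (\<lambda>x. (cmod (\<Sum>k\<in>K. c k * e k x))\<^sup>2)"
    unfolding complex_of_real_integrable_eq .
  have "of_real (LINT x|M. (cmod (\<Sum>k\<in>K. c k * e k x))\<^sup>2)
      = (LINT x|M. complex_of_real ((cmod (\<Sum>k\<in>K. c k * e k x))\<^sup>2))"
    by (rule integral_complex_of_real[symmetric])
  also have "\<dots> = (\<Sum>k\<in>K. \<Sum>l\<in>K. c k * cnj (c l) * (if k = l then 1 else 0))"
    unfolding expand using int orth by (simp cong: sum.cong)
  also have "\<dots> = (\<Sum>k\<in>K. c k * cnj (c k))"
    using \<open>finite K\<close> by (simp add: if_distrib[of "\<lambda>z. _ * z"] cong: if_cong)
  also have "\<dots> = of_real (\<Sum>k\<in>K. (cmod (c k))\<^sup>2)"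
    by (simp add: complex_norm_square del: of_real_power)
  finally show "(LINT x|M. (cmod (\<Sum>k\<in>K. c k * e k x))\<^sup>2) = (\<Sum>k\<in>K. (cmod (c k))\<^sup>2)"
    unfolding of_real_eq_iff .
qed

text \<open>
  For a unimodular orthonormal system \<open>e\<close> with \<open>N\<close> members, half of the coefficient space is
  enough to contain a combination whose value at some point is within the factor \<open>1 / sqrt 2\<close> of
  the trivial bound \<open>\<Sum>k. cmod (c k)\<close>. Let \<open>u x\<close> be the conjugated vector of the values
  \<open>e k x\<close>, so that evaluation at \<open>x\<close> is the inner product with \<open>u x\<close>, and let \<open>p\<close> be its
  projection onto the kernel. The combination with coefficients \<open>p\<close> has the value
  \<open>S x = \<parallel>p\<parallel>\<^sup>2\<close> at \<open>x\<close>, while its coefficient sum is at most \<open>sqrt N * \<parallel>p\<parallel>\<close> by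
  Cauchy--Schwarz. The quotient is at least \<open>sqrt (S x / N)\<close>, so it suffices to find a point with
  \<open>S x \<ge> N / 2\<close>. By Pythagoras and Parseval the mean of \<open>S\<close> is \<open>N - m\<close>, where \<open>m \<le> n\<close> is the
  number of orthonormal constraints, and \<open>n \<le> N / 2\<close>.
\<close>

lemma (in prob_space) exists_peaked_combination:
  fixes e :: "'k \<Rightarrow> 'a \<Rightarrow> complex" and a :: "nat \<Rightarrow> 'k \<Rightarrow> complex"
  assumes K: "finite K" "K \<noteq> {}"
    and meas: "\<And>k. k \<in> K \<Longrightarrow> e k \<in> borel_measurable M"
    and unimodular: "\<And>k x. k \<in> K \<Longrightarrow> x \<in> space M \<Longrightarrow> cmod (e k x) = 1"
    and orth: "\<And>k l. k \<in> K \<Longrightarrow> l \<in> K \<Longrightarrow>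
      (LINT x|M. e k x * cnj (e l x)) = (if k = l then 1 else 0)"
    and n: "2 * n \<le> card K"
  shows "\<exists>x\<in>space M. \<exists>c. (\<Sum>k\<in>K. cmod (c k)) = 1 \<and>
    (\<forall>j<n. (\<Sum>k\<in>K. c k * a j k) = 0) \<and>
    1 / sqrt 2 \<le> cmod (\<Sum>k\<in>K. c k * e k x)"
proof -
  define N where "N = real (card K)"
  have N: "N > 0"
    using K by (simp add: N_def card_gt_0_iff)
  obtain m v where m: "m \<le> n"
    and on: "\<And>i j. i < m \<Longrightarrow> j < m \<Longrightarrow> inner_on K (v i) (v j) = (if i = j then 1 else 0)"
    and ker: "\<And>c j. (\<And>i. i < m \<Longrightarrow> inner_on K c (v i) = 0) \<Longrightarrow> j < n \<Longrightarrow>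
      inner_on K c (\<lambda>k. cnj (a j k)) = 0"
    using orthonormal_reduction[OF K(1), of n "\<lambda>j k. cnj (a j k)"] by blast
  \<comment> \<open>\<open>T x\<close> is the squared length of the part of \<open>u x\<close> that the projection removes.\<close>
  define u where "u x = (\<lambda>k. cnj (e k x))" for x
  define S where "S x = (\<Sum>k\<in>K. (cmod (residual K m v (u x) k))\<^sup>2)" for x
  define T where "T x = (\<Sum>i<m. (cmod (\<Sum>k\<in>K. v i k * e k x))\<^sup>2)" for x
  have uv: "cmod (inner_on K (u x) (v i)) = cmod (\<Sum>k\<in>K. v i k * e k x)" for x i
  proof -
    have "inner_on K (u x) (v i) = cnj (\<Sum>k\<in>K. v i k * e k x)"
      by (simp add: inner_on_def u_def mult.commute)
    then show ?thesis
      by (metis complex_mod_cnj)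
  qed
  have S: "S x = N - T x" if "x \<in> space M" for x
    using that unimodular
    by (simp add: S_def T_def N_def pythagoras_residual[OF on] uv) (simp add: u_def)
  have v1: "(\<Sum>k\<in>K. (cmod (v i k))\<^sup>2) = 1" if "i < m" for i
    using on[OF that that] unfolding inner_on_self by (metis of_real_eq_1_iff)
  have intT: "integrable M T"
    unfolding T_def using parseval_finite(1)[OF K(1) meas unimodular orth] by auto
  have "integral\<^sup>L M T = (\<Sum>i<m. \<Sum>k\<in>K. (cmod (v i k))\<^sup>2)"
    unfolding T_def
    using parseval_finite[OF K(1) meas unimodular orth] by (simp cong: sum.cong)
  then have "integral\<^sup>L M T = m"
    using v1 by simp
  then have "integral\<^sup>L M T \<le> N / 2"
    using m n by (simp add: N_def)
  moreover have "\<not> (AE x in M. N / 2 < T x)" if "integral\<^sup>L M T \<le> N / 2"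
  proof
    assume "AE x in M. N / 2 < T x"
    then have "integral\<^sup>L M (\<lambda>_. N / 2) < integral\<^sup>L M T"
      using intT by (intro integral_less_AE_space) (auto simp: emeasure_space_1)
    then show False using that by (simp add: prob_space)
  qed
  ultimately have "\<exists>x\<in>space M. T x \<le> N / 2"
    by (metis AE_I2 not_le)
  then obtain x where x: "x \<in> space M" and "T x \<le> N / 2" by blast
  then have Sx: "N / 2 \<le> S x" using S by simp
  define p where "p = residual K m v (u x)"
  define B where "B = (\<Sum>k\<in>K. cmod (p k))"
  have Sp: "S x = (\<Sum>k\<in>K. (cmod (p k))\<^sup>2)" by (simp add: S_def p_def)
  have pv: "inner_on K p (v i) = 0" if "i < m" for i
    unfolding p_def by (rule inner_on_residual_orthogonal[OF on that])
  have "(\<Sum>k\<in>K. p k * e k x) = inner_on K p (u x)"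
    by (simp add: inner_on_def u_def)
  also have "\<dots> = inner_on K p p"
    using inner_on_residual_right[OF pv] by (simp add: p_def)
  finally have pe: "(\<Sum>k\<in>K. p k * e k x) = of_real (S x)"
    by (simp add: inner_on_self Sp)
  have pa: "(\<Sum>k\<in>K. p k * a j k) = 0" if "j < n" for j
    using ker[OF pv that] by (simp add: inner_on_def)
  have "B\<^sup>2 \<le> N * S x"
    unfolding B_def Sp N_def using sum_squared_le_sum_of_squares[of "\<lambda>k. cmod (p k)" K]
    by (simp add: mult.commute)
  also have "\<dots> \<le> 2 * (S x)\<^sup>2"
    using mult_right_mono[OF Sx, of "S x"] N Sx by (simp add: power2_eq_square)
  also have "\<dots> = (sqrt 2 * S x)\<^sup>2"
    by (simp add: power_mult_distrib)
  finally have BS: "B \<le> sqrt 2 * S x"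
    by (rule power2_le_imp_le) (use N Sx in auto)
  have "B \<noteq> 0"
  proof
    assume "B = 0"
    then have "p k = 0" if "k \<in> K" for k
      using that K(1) by (simp add: B_def sum_nonneg_eq_0_iff)
    then have "S x = 0" by (simp add: Sp)
    then show False using Sx N by simp
  qed
  then have B: "B > 0"
    using sum_nonneg[of K "\<lambda>k. cmod (p k)"] by (simp add: B_def)
  have sumdiv: "(\<Sum>k\<in>K. p k / of_real B * y k) = (\<Sum>k\<in>K. p k * y k) / of_real B" for y
    by (simp add: sum_divide_distrib)
  show ?thesis
  proof (intro bexI[of _ x] exI[of _ "\<lambda>k. p k / of_real B"] conjI allI impI)
    show "(\<Sum>k\<in>K. cmod (p k / of_real B)) = 1"
      using B by (simp add: norm_divide flip: sum_divide_distrib) (simp add: B_def)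
    have "1 / sqrt 2 \<le> S x / B"
      using B BS by (simp add: field_simps)
    then show "1 / sqrt 2 \<le> cmod (\<Sum>k\<in>K. p k / of_real B * e k x)"
      using B N Sx by (simp only: sumdiv pe) (simp add: norm_divide)
    show "(\<Sum>k\<in>K. p k / of_real B * a j k) = 0" if "j < n" for j
      by (simp only: sumdiv pa[OF that]) simp
  qed (rule x)
qed

section \<open>Characters and trigonometric polynomials on the cube\<close>

definition character :: "nat \<Rightarrow> (nat \<Rightarrow> int) \<Rightarrow> cfun" where
  "character d k = (\<lambda>x. if x \<in> cube d
     then exp (2 * pi * \<i> * of_real (\<Sum>i<d. of_int (k i) * x i)) else 0)"

definition trig_poly :: "nat \<Rightarrow> (nat \<Rightarrow> int) set \<Rightarrow> ((nat \<Rightarrow> int) \<Rightarrow> complex) \<Rightarrow> cfun" where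
  "trig_poly d K c = (\<lambda>x. \<Sum>k\<in>K. c k * character d k x)"

lemma prob_space_unit_interval: "prob_space (restrict_space lborel {0..1::real})"
  by (rule prob_spaceI) (simp add: space_restrict_space emeasure_restrict_space)

lemma prob_space_cube_measure: "prob_space (cube_measure d)"
  unfolding cube_measure_def by (rule prob_space_PiM) (rule prob_space_unit_interval)

lemma space_cube_measure: "space (cube_measure d) = cube d"
  by (simp add: cube_measure_def space_PiM cube_def space_restrict_space)

lemma product_sigma_finite_unit_interval:
  "product_sigma_finite (\<lambda>_::nat. restrict_space lborel {0..1::real})"
  by (intro product_sigma_finite.intro prob_space_imp_sigma_finite prob_space_unit_interval)

lemma integral_exp_unit_interval:
  "(LINT x|restrict_space lborel {0..1::real}. exp (2 * pi * \<i> * of_real (of_int k * x)))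
     = (if k = 0 then 1 else 0)"
proof (cases "k = 0")
  case True
  then show ?thesis
    using prob_space.prob_space[OF prob_space_unit_interval] by simp
next
  case False
  define z where "z = 2 * pi * \<i> * of_int k"
  have z: "z \<noteq> 0" using False by (simp add: z_def)
  have "exp z = 1"
    unfolding z_def exp_eq_1 by (auto intro!: exI[of _ k])
  have deriv:
    "((\<lambda>x. exp (z * of_real x) / z) has_vector_derivative exp (z * of_real x)) (at x within A)"
    for x :: real and A
  proof -
    have "((\<lambda>w. exp (z * w) / z) has_field_derivative exp (z * of_real x)) (at (of_real x))"
      using z by (auto intro!: derivative_eq_intros)
    then show ?thesis
      by (rule has_vector_derivative_real_field[THEN has_vector_derivative_at_within])
  qed
  have "(LINT x|restrict_space lborel {0..1::real}. exp (z * of_real x)) = 0"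
    using integral_FTC_Icc[of 0 1 "\<lambda>x. exp (z * of_real x) / z" "\<lambda>x. exp (z * of_real x)"] \<open>exp z = 1\<close>
    by (simp add: integral_restrict_space set_lebesgue_integral_def deriv continuous_intros)
  then show ?thesis
    using False by (simp add: z_def mult.assoc)
qed

lemma integral_character:
  "(LINT x|cube_measure d. character d k x) = (if \<forall>i<d. k i = 0 then 1 else 0)"
proof -
  interpret product_sigma_finite "\<lambda>_::nat. restrict_space lborel {0..1::real}"
    by (rule product_sigma_finite_unit_interval)
  interpret prob_space "restrict_space lborel {0..1::real}"
    by (rule prob_space_unit_interval)
  have int: "integrable (restrict_space lborel {0..1::real}) (\<lambda>x. exp (2 * pi * \<i> * of_real (of_int l * x)))" for l :: int
    by (rule integrable_const_bound[where B = 1])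
       (auto intro!: measurable_restrict_space1 borel_measurable_continuous_onI continuous_intros)
  have "(LINT x|cube_measure d. character d k x)
      = (LINT x|cube_measure d. (\<Prod>i<d. exp (2 * pi * \<i> * of_real (of_int (k i) * x i))))"
    by (rule Bochner_Integration.integral_cong)
       (auto simp: space_cube_measure character_def sum_distrib_left exp_sum)
  also have "\<dots> = (\<Prod>i<d. if k i = 0 then 1 else 0)"
    unfolding cube_measure_def using int
    by (subst product_integral_prod) (simp_all only: integral_exp_unit_interval finite_lessThan)
  also have "\<dots> = (if \<forall>i<d. k i = 0 then 1 else 0)"
    by auto
  finally show ?thesis .
qed

lemma cmod_character: "x \<in> cube d \<Longrightarrow> cmod (character d k x) = 1"
  by (simp add: character_def)

lemma character_times_cnj:
  "character d k x * cnj (character d l x) = character d (\<lambda>i. k i - l i) x"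
  by (simp add: character_def left_diff_distrib sum_subtractf exp_cnj right_diff_distrib
      flip: exp_add)

lemma character_orthonormal:
  assumes "k \<in> int_lattice d" "l \<in> int_lattice d"
  shows "(LINT x|cube_measure d. character d k x * cnj (character d l x)) = (if k = l then 1 else 0)"
proof -
  have "(\<forall>i<d. k i - l i = 0) \<longleftrightarrow> k = l"
    using assms unfolding int_lattice_def by (auto intro: PiE_ext)
  then show ?thesis
    by (simp add: character_times_cnj integral_character)
qed

lemma continuous_on_character: "continuous_on (cube d) (character d k)"
proof -
  have "continuous_on (cube d) (\<lambda>x. exp (2 * pi * \<i> * of_real (\<Sum>i<d. of_int (k i) * x i)))"
    by (intro continuous_intros continuous_on_subset[OF continuous_on_product_coordinates]) auto
  then show ?thesis
    by (rule continuous_on_eq) (simp add: character_def)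
qed

lemma borel_measurable_character: "character d k \<in> borel_measurable (cube_measure d)"
proof -
  have coord: "(\<lambda>x. x i) \<in> borel_measurable (cube_measure d)" if "i < d" for i
  proof -
    have "(\<lambda>x. x i) \<in> cube_measure d \<rightarrow>\<^sub>M restrict_space lborel {0..1}"
      unfolding cube_measure_def using that by (intro measurable_component_singleton) auto
    then show ?thesis
      by (simp add: measurable_restrict_space2_iff)
  qed
  have "(\<lambda>x. exp (2 * pi * \<i> * of_real (\<Sum>i<d. of_int (k i) * x i))) \<in> borel_measurable (cube_measure d)"
    using coord
    by (intro borel_measurable_continuous_on[of "\<lambda>t. exp (2 * pi * \<i> * of_real t)"]
        continuous_intros borel_measurable_sum borel_measurable_times) auto
  then show ?thesis
    by (rule measurable_cong[THEN iffD1, rotated]) (simp add: space_cube_measure character_def)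
qed

lemma integrable_character_times_cnj:
  "integrable (cube_measure d) (\<lambda>x. character d k x * cnj (character d l x))"
proof -
  interpret prob_space "cube_measure d" by (rule prob_space_cube_measure)
  have "integrable (cube_measure d) (character d k)" for k
    by (rule integrable_const_bound[where B = 1])
       (auto simp: borel_measurable_character space_cube_measure cmod_character)
  then show ?thesis
    by (simp add: character_times_cnj)
qed

lemma fourier_coeff_trig_poly:
  assumes "finite K" "K \<subseteq> int_lattice d" "l \<in> int_lattice d"
  shows "fourier_coeff d (trig_poly d K c) l = (if l \<in> K then c l else 0)"
proof -
  have "fourier_coeff d (trig_poly d K c) l
      = (LINT x|cube_measure d. (\<Sum>k\<in>K. c k * (character d k x * cnj (character d l x))))"
    unfolding fourier_coeff_def trig_poly_def
  proof (rule Bochner_Integration.integral_cong)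
    fix x assume "x \<in> space (cube_measure d)"
    then have "exp (- 2 * pi * \<i> * of_real (\<Sum>i<d. of_int (l i) * x i)) = cnj (character d l x)"
      by (simp add: space_cube_measure character_def exp_cnj)
    then show "(\<Sum>k\<in>K. c k * character d k x) * exp (- 2 * pi * \<i> * of_real (\<Sum>i<d. of_int (l i) * x i))
        = (\<Sum>k\<in>K. c k * (character d k x * cnj (character d l x)))"
      by (simp only: sum_distrib_right mult.assoc)
  qed simp
  also have "\<dots> = (\<Sum>k\<in>K. c k * (if k = l then 1 else 0))"
    using assms integrable_character_times_cnj character_orthonormal[OF _ assms(3)]
    by (simp add: subset_iff cong: sum.cong)
  also have "\<dots> = (if l \<in> K then c l else 0)"
    using \<open>finite K\<close> by (simp add: if_distrib[of "\<lambda>z. _ * z"] cong: if_cong)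
  finally show ?thesis .
qed

lemma trig_poly_in_C_cube: "trig_poly d K c \<in> C_cube d"
  unfolding C_cube_def trig_poly_def
  by (auto intro!: continuous_intros continuous_on_character) (simp add: character_def)

section \<open>The frequencies of weight one\<close>

text \<open>
  The bound \<open>2\<close> is the largest integer whose logarithm is at most \<open>1\<close>. Hence these \<open>5 ^ d\<close>
  frequencies all have weight \<open>1\<close>, and for their combinations the sum that defines \<open>F_log d\<close> is the plain
  \<open>\<ell>\<^sub>1\<close> norm of the coefficients.
\<close>

definition low_freqs :: "nat \<Rightarrow> (nat \<Rightarrow> int) set" where
  "low_freqs d = {..<d} \<rightarrow>\<^sub>E {-2..2}"

lemma finite_low_freqs: "finite (low_freqs d)"
  unfolding low_freqs_def by (intro finite_PiE) auto

lemma card_low_freqs: "card (low_freqs d) = 5 ^ d"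
  by (simp add: low_freqs_def card_PiE)

lemma low_freqs_subset: "low_freqs d \<subseteq> int_lattice d"
  unfolding low_freqs_def int_lattice_def by (intro PiE_mono) auto

lemma log_weight_low_freqs:
  assumes "k \<in> low_freqs d"
  shows "log_weight d k = 1"
proof (cases "\<forall>i<d. k i = 0")
  case False
  then obtain i where i: "i < d" "k i \<noteq> 0" by blast
  have ne: "(\<lambda>i. \<bar>k i\<bar>) ` {..<d} \<noteq> {}" using i by auto
  have le: "\<bar>k i\<bar> \<le> 2" if "i < d" for i
    using assms that by (force simp: low_freqs_def PiE_iff)
  have "Max ((\<lambda>i. \<bar>k i\<bar>) ` {..<d}) \<le> 2"
    using ne le by (subst Max_le_iff) auto
  moreover have "\<bar>k i\<bar> \<le> Max ((\<lambda>i. \<bar>k i\<bar>) ` {..<d})"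
    using i by (intro Max_ge) auto
  ultimately have "0 < sup_norm d k" "sup_norm d k \<le> 2"
    using i unfolding sup_norm_def by linarith+
  then have "ln (sup_norm d k) \<le> 1"
    using ln_le_minus_one[of "sup_norm d k"] by linarith
  then show ?thesis using False by (simp add: log_weight_def)
qed (simp add: log_weight_def)

lemma trig_poly_in_F_log:
  assumes "(\<Sum>k\<in>low_freqs d. cmod (c k)) \<le> 1"
  shows "trig_poly d (low_freqs d) c \<in> F_log d"
proof -
  let ?f = "trig_poly d (low_freqs d) c"
  let ?s = "\<lambda>k. cmod (fourier_coeff d ?f k) * log_weight d k"
  have "(?s has_sum (\<Sum>k\<in>low_freqs d. ?s k)) (low_freqs d)"
    by (rule has_sum_finite[OF finite_low_freqs])
  moreover have "(\<Sum>k\<in>low_freqs d. ?s k) = (\<Sum>k\<in>low_freqs d. cmod (c k))"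
    by (intro sum.cong) (simp_all add: fourier_coeff_trig_poly finite_low_freqs
        low_freqs_subset subsetD[OF low_freqs_subset] log_weight_low_freqs)
  moreover have "?s k = 0" if "k \<in> int_lattice d - low_freqs d" for k
    using that by (simp add: fourier_coeff_trig_poly finite_low_freqs low_freqs_subset)
  ultimately have "(?s has_sum (\<Sum>k\<in>low_freqs d. cmod (c k))) (int_lattice d)"
    using low_freqs_subset
    by (subst has_sum_cong_neutral[of "low_freqs d" "int_lattice d" ?s ?s]) auto
  then show ?thesis
    using assms trig_poly_in_C_cube
    by (simp add: F_log_def infsumI has_sum_imp_summable)
qed

section \<open>Essential bounds of continuous functions\<close>

lemma emeasure_unit_interval_open_pos:
  fixes X :: "real set"
  assumes "open X" "a \<in> X" "a \<in> {0..1}"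
  shows "emeasure (restrict_space lborel {0..1}) (X \<inter> {0..1}) \<noteq> 0"
proof -
  obtain e where e: "e > 0" "ball a e \<subseteq> X"
    using assms openE by blast
  \<comment> \<open>The point \<open>a\<close> may be an end point of the interval, so the ball is cut down to its inner part.\<close>
  define l r where "l = max 0 (a - e)" and "r = min 1 (a + e)"
  have "l < r" using e assms by (auto simp: l_def r_def)
  have "{l<..<r} \<subseteq> X \<inter> {0..1}"
    using e by (auto simp: l_def r_def subset_iff dist_real_def abs_if)
  then have "emeasure lborel {l<..<r} \<le> emeasure lborel (X \<inter> {0..1})"
    using assms by (intro emeasure_mono) auto
  moreover have "emeasure lborel {l<..<r} \<noteq> 0"
    using \<open>l < r\<close> by simp
  ultimately show ?thesis
    by (auto simp: emeasure_restrict_space)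
qed

text \<open>
  The cube measure charges every nonempty relatively open subset of the cube, because such a set
  contains a box with sides of positive length. A continuous function therefore cannot exceed an
  almost everywhere bound at any point.
\<close>

lemma AE_cube_continuous_le:
  fixes f :: "(nat \<Rightarrow> real) \<Rightarrow> real"
  assumes cont: "continuous_on (cube d) f"
    and ae: "AE x in cube_measure d. f x \<le> s"
    and "x0 \<in> cube d"
  shows "f x0 \<le> s"
proof (rule ccontr)
  interpret product_sigma_finite "\<lambda>_::nat. restrict_space lborel {0..1::real}"
    by (rule product_sigma_finite_unit_interval)
  assume "\<not> f x0 \<le> s"
  then obtain U where U: "open U" "U \<inter> cube d = f -` {s<..} \<inter> cube d" "x0 \<in> U"
    using cont \<open>x0 \<in> cube d\<close> unfolding continuous_on_open_invariant
    by (metis IntD1 IntI greaterThan_iff linorder_not_le open_greaterThan vimageI)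
  obtain X where X: "x0 \<in> Pi\<^sub>E UNIV X" "\<And>i. open (X i)" "Pi\<^sub>E UNIV X \<subseteq> U"
    using product_topology_open_contains_basis[of "\<lambda>_. euclidean" UNIV U x0] U
    by (auto simp: open_fun_def)
  define W where "W = (\<Pi>\<^sub>E i\<in>{..<d}. X i \<inter> {0..1})"
  have large: "s < f y" if "y \<in> W" for y
  proof -
    have "y i \<in> X i" for i
    \<comment> \<open>The coordinates from \<open>d\<close> on have the same default value for all points of the cube.\<close>
    proof (cases "i < d")
      case False
      then have "y i = undefined" "x0 i = undefined"
        using that \<open>x0 \<in> cube d\<close> by (auto simp: W_def cube_def PiE_iff extensional_def)
      then show ?thesis using X(1) by (metis PiE_mem UNIV_I)
    qed (use that in \<open>auto simp: W_def PiE_iff\<close>)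
    then have "y \<in> U" using X(3) by auto
    moreover have "y \<in> cube d"
      using that by (auto simp: W_def cube_def PiE_iff)
    ultimately show ?thesis using U(2) by auto
  qed
  have "AE x in cube_measure d. x \<notin> W"
    using ae by (rule eventually_mono) (use large in \<open>meson not_le\<close>)
  moreover have "W \<subseteq> space (cube_measure d)"
    unfolding space_cube_measure W_def cube_def by (intro PiE_mono) auto
  then have "{x \<in> space (cube_measure d). x \<in> W} = W"
    by blast
  ultimately have "emeasure (cube_measure d) W = 0"
    by (metis emeasure_eq_0_AE)
  moreover have "emeasure (cube_measure d) W
      = (\<Prod>i<d. emeasure (restrict_space lborel {0..1}) (X i \<inter> {0..1}))"
    unfolding cube_measure_def W_def using X(2)
    by (intro emeasure_PiM) (auto simp: sets_restrict_space)
  ultimately obtain i where "i < d" "emeasure (restrict_space lborel {0..1}) (X i \<inter> {0..1}) = 0"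
    by auto
  moreover have "x0 i \<in> X i" "x0 i \<in> {0..1}" if "i < d" for i
    using X(1) \<open>x0 \<in> cube d\<close> that by (auto simp: cube_def PiE_iff)
  ultimately show False
    using emeasure_unit_interval_open_pos X(2) by blast
qed

section \<open>The adversary argument\<close>

lemma trig_poly_empty: "trig_poly d {} c = 0"
  by (simp add: trig_poly_def fun_eq_iff)

lemma trig_poly_insert:
  "finite K \<Longrightarrow> k \<notin> K \<Longrightarrow>
     trig_poly d (insert k K) c = cfun_scale (c k) (character d k) + trig_poly d K c"
  by (simp add: trig_poly_def cfun_scale_def fun_eq_iff)

lemma trig_poly_uminus: "trig_poly d K (\<lambda>k. - c k) = - trig_poly d K c"
  by (simp add: trig_poly_def fun_eq_iff sum_negf)

lemma linear_functional_trig_poly: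
  assumes "finite K" "linear_functional_on F L" "\<And>k. k \<in> K \<Longrightarrow> character d k \<in> F"
  shows "trig_poly d K c \<in> cfun.span F \<and> L (trig_poly d K c) = (\<Sum>k\<in>K. c k * L (character d k))"
  using assms(1,3)
proof (induction K)
  case empty
  have "L (cfun_scale 0 0) = 0 * L 0"
    using assms(2) cfun.span_zero unfolding linear_functional_on_def by blast
  then have "L 0 = 0"
    by (simp only: cfun.scale_zero_left mult_zero_left)
  then show ?case by (simp only: trig_poly_empty cfun.span_zero sum.empty simp_thms)
next
  case (insert k K)
  have k: "character d k \<in> cfun.span F"
    using insert.prems by (simp add: cfun.span_base)
  then have "cfun_scale (c k) (character d k) \<in> cfun.span F"
    by (rule cfun.span_scale)
  moreover have IH: "trig_poly d K c \<in> cfun.span F" "L (trig_poly d K c) = (\<Sum>k\<in>K. c k * L (character d k))"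
    using insert by auto
  ultimately have "L (trig_poly d (insert k K) c) = L (cfun_scale (c k) (character d k)) + L (trig_poly d K c)"
    using assms(2) unfolding trig_poly_insert[OF insert.hyps] linear_functional_on_def by blast
  moreover have "L (cfun_scale (c k) (character d k)) = c k * L (character d k)"
    using assms(2) k unfolding linear_functional_on_def by blast
  moreover have "trig_poly d (insert k K) c \<in> cfun.span F"
    unfolding trig_poly_insert[OF insert.hyps] by (intro cfun.span_add cfun.span_scale k IH)
  ultimately show ?case
    using insert.hyps IH(2) by simp
qed

text \<open>
  A function annihilated by the functionals that are chosen after observing only zeros produces
  only zeros. For such a function adaptivity has no effect, and finitely many linear constraints
  describe it.
\<close>

lemma adaptive_info_zero:
  assumes "\<And>j. j < n \<Longrightarrow> L (replicate j 0) f = 0"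
  shows "adaptive_info L n f = replicate n 0"
  using assms by (induction n) (simp_all add: replicate_append_same)

lemma character_in_F_log:
  assumes "k \<in> low_freqs d"
  shows "character d k \<in> F_log d"
proof -
  have "character d k = trig_poly d (low_freqs d) (\<lambda>l. if l = k then 1 else 0)"
    unfolding trig_poly_def using assms finite_low_freqs[of d]
    by (intro ext) (simp add: if_distrib[of "\<lambda>z. z * _"] cong: if_cong)
  also have "\<dots> \<in> F_log d"
    using assms finite_low_freqs[of d]
    by (intro trig_poly_in_F_log) (simp add: if_distrib[of cmod] cong: if_cong)
  finally show ?thesis .
qed

text \<open>
  An algorithm that gives the same answer \<open>g\<close> to \<open>f\<close> and \<open>- f\<close> errs by at least \<open>\<bar>f x\<bar>\<close>, since
  \<open>2 f = (f - g) - (- f - g)\<close>. The triangle inequality is applied pointwise almost everywhere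
  and transferred to the point \<open>x\<close> by continuity of \<open>f\<close>.
\<close>

lemma worst_case_error_symmetric_pair:
  assumes f: "f \<in> F" "- f \<in> F" "A (- f) = A f"
    and cont: "continuous_on (cube d) f" and "x \<in> cube d"
  shows "ereal (cmod (f x)) \<le> worst_case_error d F A"
proof (rule ccontr)
  let ?g = "A f"
  assume "\<not> ?thesis"
  then have "worst_case_error d F A < ereal (cmod (f x))"
    by simp
  from ereal_dense2[OF this] obtain t
    where t: "worst_case_error d F A < ereal t" "ereal t < ereal (cmod (f x))"
    by blast
  have small: "AE y in cube_measure d. cmod ((h - ?g) y) \<le> t" if "h \<in> F" "A h = ?g" for h
  proof -
    have ae: "AE y in cube_measure d. ereal (cmod ((h - ?g) y)) \<le> Linf_norm d (h - ?g)"
      unfolding Linf_norm_def by (rule esssup_AE)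
    have "Linf_norm d (h - ?g) \<le> worst_case_error d F A"
      unfolding worst_case_error_def using SUP_upper[OF that(1), of "\<lambda>f. Linf_norm d (f - A f)"] that(2)
      by simp
    then have "Linf_norm d (h - ?g) \<le> ereal t"
      using t(1) by simp
    then show ?thesis
      using eventually_mono[OF ae, of "\<lambda>y. cmod ((h - ?g) y) \<le> t"]
      by (meson ereal_less_eq(3) order_trans)
  qed
  have "AE y in cube_measure d. cmod (f y) \<le> t"
    using small[OF f(1) refl] small[OF f(2,3)]
  proof eventually_elim
    case (elim y)
    have "2 * cmod (f y) = cmod ((f - ?g) y - (- f - ?g) y)"
      by (simp flip: mult_2 add: norm_mult)
    also have "\<dots> \<le> cmod ((f - ?g) y) + cmod ((- f - ?g) y)"
      by (rule norm_triangle_ineq4)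
    finally show ?case using elim by linarith
  qed
  then have "cmod (f x) \<le> t"
    using cont \<open>x \<in> cube d\<close>
    by (intro AE_cube_continuous_le[of d "\<lambda>y. cmod (f y)"] continuous_intros)
  then show False using t(2) by simp
qed

lemma adaptive_worst_case_error_lower_bound:
  assumes n: "2 * n \<le> 5 ^ d" and A: "A \<in> adaptive_algorithms d (F_log d) n"
  shows "ereal (1 / sqrt 2) \<le> worst_case_error d (F_log d) A"
proof -
  interpret prob_space "cube_measure d" by (rule prob_space_cube_measure)
  obtain L \<phi> where lin: "\<And>ys. length ys < n \<Longrightarrow> linear_functional_on (F_log d) (L ys)"
    and A: "\<And>f. f \<in> F_log d \<Longrightarrow> A f = \<phi> (adaptive_info L n f)"
    using A unfolding adaptive_algorithms_def by blast
  let ?K = "low_freqs d"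
  have K: "2 * n \<le> card ?K" and ne: "?K \<noteq> {}"
    using n card_low_freqs[of d] by (simp, metis card.empty power_not_zero zero_neq_numeral)
  have orth: "(LINT x|cube_measure d. character d k x * cnj (character d l x)) = (if k = l then 1 else 0)"
    if "k \<in> ?K" "l \<in> ?K" for k l
    using that low_freqs_subset[of d] by (intro character_orthonormal) auto
  have unimodular: "cmod (character d k x) = 1" if "k \<in> ?K" "x \<in> space (cube_measure d)" for k x
    using that by (simp add: space_cube_measure cmod_character)
  have "\<exists>x\<in>space (cube_measure d). \<exists>c. (\<Sum>k\<in>?K. cmod (c k)) = 1 \<and>
      (\<forall>j<n. (\<Sum>k\<in>?K. c k * L (replicate j 0) (character d k)) = 0) \<and>
      1 / sqrt 2 \<le> cmod (\<Sum>k\<in>?K. c k * character d k x)"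
    by (rule exists_peaked_combination[OF finite_low_freqs ne borel_measurable_character
          unimodular orth K])
  then obtain c x where x: "x \<in> cube d" and c: "(\<Sum>k\<in>?K. cmod (c k)) = 1"
    and ker: "\<And>j. j < n \<Longrightarrow> (\<Sum>k\<in>?K. c k * L (replicate j 0) (character d k)) = 0"
    and big: "1 / sqrt 2 \<le> cmod (\<Sum>k\<in>?K. c k * character d k x)"
    unfolding space_cube_measure by blast
  define f where "f = trig_poly d ?K c"
  have mf: "- f = trig_poly d ?K (\<lambda>k. - c k)"
    by (simp add: f_def trig_poly_uminus)
  have F: "f \<in> F_log d" "- f \<in> F_log d"
    unfolding mf unfolding f_def using c by (auto intro!: trig_poly_in_F_log)
  have L: "L (replicate j 0) (trig_poly d ?K b) = (\<Sum>k\<in>?K. b k * L (replicate j 0) (character d k))"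
    if "j < n" for j b
    using linear_functional_trig_poly[OF finite_low_freqs lin character_in_F_log] that by simp
  have "adaptive_info L n f = replicate n 0" "adaptive_info L n (- f) = replicate n 0"
    unfolding mf unfolding f_def using ker
    by (auto intro!: adaptive_info_zero simp: L sum_negf)
  then have "A (- f) = A f" using A F by simp
  then have "ereal (cmod (f x)) \<le> worst_case_error d (F_log d) A"
    using F x trig_poly_in_C_cube[of d ?K c]
    by (intro worst_case_error_symmetric_pair) (auto simp: f_def C_cube_def)
  moreover have "ereal (1 / sqrt 2) \<le> ereal (cmod (f x))"
    using big by (simp add: f_def trig_poly_def)
  ultimately show ?thesis by (rule order_trans[rotated])
qed

text \<open>
  Point evaluations are linear, and the length of the observed list tells which one comes next.
\<close>

lemma sampling_algorithms_subset: "sampling_algorithms d F n \<subseteq> adaptive_algorithms d F n"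
proof
  fix A assume "A \<in> sampling_algorithms d F n"
  then obtain x \<phi> where \<phi>: "\<forall>ys. length ys = n \<longrightarrow> \<phi> ys \<in> Linf d"
    and A: "\<forall>f\<in>F. A f = \<phi> (map (\<lambda>j. f (x j)) [0..<n])"
    unfolding sampling_algorithms_def by blast
  define L :: "complex list \<Rightarrow> cfun \<Rightarrow> complex" where "L ys f = f (x (length ys))" for ys f
  have "adaptive_info L m f = map (\<lambda>j. f (x j)) [0..<m]" for m f
    by (induction m) (simp_all add: L_def)
  moreover have "linear_functional_on F (L ys)" for ys
    by (simp add: linear_functional_on_def L_def cfun_scale_def)
  ultimately show "A \<in> adaptive_algorithms d F n"
    unfolding adaptive_algorithms_def using \<phi> A by (intro CollectI exI[of _ L] exI[of _ \<phi>]) simp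
qed

text \<open>
  Any accuracy below \<open>1 / sqrt 2\<close> gives the curse; \<open>\<epsilon> = 1 / 2\<close> with \<open>C = 1 / 2\<close> and
  \<open>1 + \<gamma> = 5\<close> is used here.
\<close>

lemma curse_of_dimensionality_F_log:
  assumes "\<And>d n. alg d (F_log d) n \<subseteq> adaptive_algorithms d (F_log d) n"
  shows "curse_of_dimensionality alg F_log"
proof -
  have "ereal (1 / 2 * (1 + 4) ^ d) \<le> ereal_of_enat (info_complexity alg F_log (1 / 2) d)" for d
  proof -
    define S where "S = {enat n | n. \<exists>A\<in>alg d (F_log d) n. worst_case_error d (F_log d) A \<le> ereal (1 / 2)}"
    have many: "ereal (1 / 2 * 5 ^ d) \<le> ereal_of_enat N" if N: "N \<in> S" for N
    proof -
      obtain n A where nA: "N = enat n" "A \<in> alg d (F_log d) n"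
        "worst_case_error d (F_log d) A \<le> ereal (1 / 2)"
        using N unfolding S_def by blast
      have "sqrt 2 < 2"
        by (rule real_less_lsqrt) auto
      then have "ereal (1 / 2) < ereal (1 / sqrt 2)"
        by (simp add: field_simps)
      then have "\<not> ereal (1 / sqrt 2) \<le> worst_case_error d (F_log d) A"
        using nA(3) by (metis leD order_trans)
      then have "\<not> 2 * n \<le> 5 ^ d"
        using adaptive_worst_case_error_lower_bound assms nA(2) by blast
      then have "(5::real) ^ d < 2 * real n"
        by (metis (mono_tags) not_le of_nat_less_iff of_nat_mult of_nat_numeral of_nat_power)
      then show ?thesis by (simp add: nA(1))
    qed
    have "ereal (1 / 2 * 5 ^ d) \<le> ereal_of_enat (Inf S)"
    proof (cases "S = {}")
      case False
      then have "Inf S \<in> S"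
        by (auto simp: Inf_enat_def intro: LeastI)
      then show ?thesis by (rule many)
    qed (simp add: top_enat_def)
    then show ?thesis by (simp add: info_complexity_def S_def)
  qed
  then show ?thesis
    unfolding curse_of_dimensionality_def
    by (intro exI[of _ "1/2"] exI[of _ 4] conjI allI impI) auto
qed

theorem corollary19:
  shows "curse_of_dimensionality adaptive_algorithms F_log
    \<and> curse_of_dimensionality sampling_algorithms F_log
    \<and> (\<forall>d\<ge>1. \<forall>n. real n \<le> 5 ^ d / 2 \<longrightarrow>
         (\<forall>A\<in>adaptive_algorithms d (F_log d) n.
            ereal (1 / sqrt 2) \<le> worst_case_error d (F_log d) A))"
proof (intro conjI allI impI ballI)
  show "curse_of_dimensionality adaptive_algorithms F_log"
    by (rule curse_of_dimensionality_F_log) simp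
  show "curse_of_dimensionality sampling_algorithms F_log"
    by (rule curse_of_dimensionality_F_log) (rule sampling_algorithms_subset)
next
  fix d n A
  assume "real n \<le> 5 ^ d / 2" and "A \<in> adaptive_algorithms d (F_log d) n"
  moreover from this have "real (2 * n) \<le> real (5 ^ d)" by simp
  then have "2 * n \<le> 5 ^ d" by (simp only: of_nat_le_iff)
  ultimately show "ereal (1 / sqrt 2) \<le> worst_case_error d (F_log d) A"
    by (intro adaptive_worst_case_error_lower_bound)
qed

end
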